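(* Let $IS(n)$ denote the cardinality of the set of isomorphism classes of games on a set of size $2n+1$. Then $$IS(n) \ \geq \ \frac{2^{n(n-1)}}{(2n+1)\cdot (n!)^2}.$$ If $n \geq 7$, then $$\ln (IS(n)) \ \geq \ n \cdot [\, n \ln 2 \ - \ 2 \ln n \,].$$
   Context: A tournament on a finite set $I$ is a relation $\Pi \subset I \times I$ containing no pair $(i,i)$ and such that for every pair of distinct $i,j \in I$ exactly one of $(i,j),(j,i)$ lies in $\Pi$. A game on $I$ is a regular tournament: $|I| = 2n+1$ is odd and every $i\in I$ has exactly $n$ outputs $j$ (with $(i,j)\in\Pi$) and $n$ inputs. Two games $\Pi$ on $I$ and $\Gamma$ on $J$ are isomorphic when there is a bijection $\rho : I \to J$ with $(i,j) \in \Pi \Leftrightarrow (\rho(i),\rho(j)) \in \Gamma$. *)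

theory Defs
  imports Complex_Main
begin

definition tournament_on :: "'a set \<Rightarrow> 'a rel \<Rightarrow> bool" where
  "tournament_on I P \<longleftrightarrow>
     finite I \<and> P \<subseteq> I \<times> I \<and> (\<forall>i. (i, i) \<notin> P) \<and>
     (\<forall>i\<in>I. \<forall>j\<in>I. i \<noteq> j \<longrightarrow> ((i, j) \<in> P) \<noteq> ((j, i) \<in> P))"

definition game_on :: "'a set \<Rightarrow> 'a rel \<Rightarrow> bool" where
  "game_on I P \<longleftrightarrow> tournament_on I P \<and>
     (\<exists>n. card I = 2 * n + 1 \<and>
        (\<forall>i\<in>I. card {j. (i, j) \<in> P} = n \<and> card {j. (j, i) \<in> P} = n))"

definition game_isomorphic :: "'a set \<Rightarrow> 'a rel \<Rightarrow> 'b set \<Rightarrow> 'b rel \<Rightarrow> bool" where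
  "game_isomorphic I P J Q \<longleftrightarrow>
     (\<exists>\<rho>. bij_betw \<rho> I J \<and> (\<forall>i\<in>I. \<forall>j\<in>I. (i, j) \<in> P \<longleftrightarrow> (\<rho> i, \<rho> j) \<in> Q))"

definition game_iso_rel :: "'a set \<Rightarrow> 'a rel rel" where
  "game_iso_rel I = {(P, Q). game_on I P \<and> game_on I Q \<and> game_isomorphic I P I Q}"

definition game_iso_classes :: "'a set \<Rightarrow> 'a rel set set" where
  "game_iso_classes I = {P. game_on I P} // game_iso_rel I"

text \<open>The choice of the underlying set is immaterial, see \<open>card_game_iso_classes\<close> below.\<close>

definition IS :: "nat \<Rightarrow> nat" where
  "IS n = card (game_iso_classes {..<2 * n + 1})"

lemma game_isomorphic_refl: "game_isomorphic I P I P"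
  unfolding game_isomorphic_def by (rule exI[of _ id]) auto

lemma game_isomorphic_sym:
  assumes "game_isomorphic I P J Q"
  shows "game_isomorphic J Q I P"
proof -
  obtain \<rho> where bij: "bij_betw \<rho> I J"
    and iso: "\<forall>i\<in>I. \<forall>j\<in>I. (i, j) \<in> P \<longleftrightarrow> (\<rho> i, \<rho> j) \<in> Q"
    using assms unfolding game_isomorphic_def by blast
  have "bij_betw (inv_into I \<rho>) J I"
    using bij by (rule bij_betw_inv_into)
  moreover have "\<forall>i\<in>J. \<forall>j\<in>J. (i, j) \<in> Q \<longleftrightarrow> (inv_into I \<rho> i, inv_into I \<rho> j) \<in> P"
  proof (intro ballI)
    fix i j assume "i \<in> J" "j \<in> J"
    then obtain a b where "a \<in> I" "b \<in> I" "i = \<rho> a" "j = \<rho> b"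
      using bij unfolding bij_betw_def by blast
    then show "(i, j) \<in> Q \<longleftrightarrow> (inv_into I \<rho> i, inv_into I \<rho> j) \<in> P"
      using bij iso by (simp add: bij_betw_inv_into_left)
  qed
  ultimately show ?thesis
    unfolding game_isomorphic_def by blast
qed

lemma game_isomorphic_trans:
  assumes "game_isomorphic I P J Q" and "game_isomorphic J Q K R"
  shows "game_isomorphic I P K R"
proof -
  obtain \<rho> where r: "bij_betw \<rho> I J"
    "\<forall>i\<in>I. \<forall>j\<in>I. (i, j) \<in> P \<longleftrightarrow> (\<rho> i, \<rho> j) \<in> Q"
    using assms(1) unfolding game_isomorphic_def by blast
  obtain \<sigma> where s: "bij_betw \<sigma> J K"
    "\<forall>i\<in>J. \<forall>j\<in>J. (i, j) \<in> Q \<longleftrightarrow> (\<sigma> i, \<sigma> j) \<in> R"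
    using assms(2) unfolding game_isomorphic_def by blast
  have "bij_betw (\<sigma> \<circ> \<rho>) I K"
    using r(1) s(1) by (rule bij_betw_trans)
  moreover have "\<forall>i\<in>I. \<forall>j\<in>I. (i, j) \<in> P \<longleftrightarrow> ((\<sigma> \<circ> \<rho>) i, (\<sigma> \<circ> \<rho>) j) \<in> R"
    using r s by (auto dest: bij_betwE)
  ultimately show ?thesis
    unfolding game_isomorphic_def by blast
qed

lemma game_isomorphic_cong:
  assumes "game_isomorphic I P J Q"
  shows "game_isomorphic I P K R \<longleftrightarrow> game_isomorphic J Q K R"
  using game_isomorphic_trans[OF assms, of K R]
    game_isomorphic_trans[OF game_isomorphic_sym[OF assms], of K R] by (rule iffI[rotated])

lemma equiv_game_iso_rel: "equiv {P. game_on I P} (game_iso_rel I)"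
proof (rule equivI)
  show "game_iso_rel I \<subseteq> {P. game_on I P} \<times> {P. game_on I P}"
    by (auto simp: game_iso_rel_def)
  show "refl_on {P. game_on I P} (game_iso_rel I)"
    by (auto simp: refl_on_def game_iso_rel_def game_isomorphic_refl)
  show "sym (game_iso_rel I)"
    by (auto simp: sym_def game_iso_rel_def intro: game_isomorphic_sym)
  show "trans (game_iso_rel I)"
    by (rule transI) (auto simp: game_iso_rel_def dest: game_isomorphic_cong)
qed

lemma game_on_transport:
  assumes P: "game_on I P" and bij: "bij_betw \<rho> I J"
  shows "game_on J (map_prod \<rho> \<rho> ` P) \<and> game_isomorphic I P J (map_prod \<rho> \<rho> ` P)"
proof -
  have sub: "P \<subseteq> I \<times> I" and fin: "finite I"
    and irr: "\<And>i. (i, i) \<notin> P"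
    and tot: "\<And>i j. i \<in> I \<Longrightarrow> j \<in> I \<Longrightarrow> i \<noteq> j \<Longrightarrow> ((i, j) \<in> P) \<noteq> ((j, i) \<in> P)"
    using P unfolding game_on_def tournament_on_def by blast+
  obtain n where n: "card I = 2 * n + 1"
    "\<And>i. i \<in> I \<Longrightarrow> card {j. (i, j) \<in> P} = n" "\<And>i. i \<in> I \<Longrightarrow> card {j. (j, i) \<in> P} = n"
    using P unfolding game_on_def by blast
  have inj: "inj_on \<rho> I" and J: "J = \<rho> ` I"
    using bij by (auto simp: bij_betw_def)
  define Q where "Q = map_prod \<rho> \<rho> ` P"
  have mem: "(\<rho> i, \<rho> j) \<in> Q \<longleftrightarrow> (i, j) \<in> P" if "i \<in> I" "j \<in> I" for i j
  proof
    assume "(\<rho> i, \<rho> j) \<in> Q"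
    then obtain a b where ab: "(a, b) \<in> P" "\<rho> i = \<rho> a" "\<rho> j = \<rho> b"
      unfolding Q_def by auto
    then have "a \<in> I" "b \<in> I" using sub by auto
    with ab that inj show "(i, j) \<in> P" by (simp add: inj_on_eq_iff)
  next
    assume "(i, j) \<in> P"
    then show "(\<rho> i, \<rho> j) \<in> Q" unfolding Q_def by (rule rev_image_eqI) simp
  qed
  have Qsub: "Q \<subseteq> J \<times> J"
    unfolding Q_def using sub J by auto
  have co: "card {j. (\<rho> i, j) \<in> Q} = n" if i: "i \<in> I" for i
  proof -
    have sub': "{j. (i, j) \<in> P} \<subseteq> I" using sub by auto
    have "{j. (\<rho> i, j) \<in> Q} = \<rho> ` {j. (i, j) \<in> P}"
    proof (intro set_eqI iffI)
      fix y assume y: "y \<in> {j. (\<rho> i, j) \<in> Q}"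
      then obtain j where j: "j \<in> I" "y = \<rho> j" using Qsub J by auto
      with y show "y \<in> \<rho> ` {j. (i, j) \<in> P}" using mem[OF i j(1)] by simp
    next
      fix y assume "y \<in> \<rho> ` {j. (i, j) \<in> P}"
      then obtain j where j: "y = \<rho> j" "(i, j) \<in> P" by auto
      then show "y \<in> {j. (\<rho> i, j) \<in> Q}" using mem[OF i] sub' by auto
    qed
    then show ?thesis
      using card_image[OF inj_on_subset[OF inj sub']] n(2)[OF i] by simp
  qed
  have ci: "card {j. (j, \<rho> i) \<in> Q} = n" if i: "i \<in> I" for i
  proof -
    have sub': "{j. (j, i) \<in> P} \<subseteq> I" using sub by auto
    have "{j. (j, \<rho> i) \<in> Q} = \<rho> ` {j. (j, i) \<in> P}"
    proof (intro set_eqI iffI)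
      fix y assume y: "y \<in> {j. (j, \<rho> i) \<in> Q}"
      then obtain j where j: "j \<in> I" "y = \<rho> j" using Qsub J by auto
      with y show "y \<in> \<rho> ` {j. (j, i) \<in> P}" using mem[OF j(1) i] by simp
    next
      fix y assume "y \<in> \<rho> ` {j. (j, i) \<in> P}"
      then obtain j where j: "y = \<rho> j" "(j, i) \<in> P" by auto
      then show "y \<in> {j. (j, \<rho> i) \<in> Q}" using mem[OF _ i] sub' by auto
    qed
    then show ?thesis
      using card_image[OF inj_on_subset[OF inj sub']] n(3)[OF i] by simp
  qed
  have irrQ: "(y, y) \<notin> Q" for y
  proof
    assume y: "(y, y) \<in> Q"
    then obtain i where "i \<in> I" "y = \<rho> i" using Qsub J by auto
    with y show False using mem irr by simp
  qed
  have "((x, y) \<in> Q) \<noteq> ((y, x) \<in> Q)" if xy: "x \<in> J" "y \<in> J" "x \<noteq> y" for x y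
  proof -
    obtain i j where ij: "i \<in> I" "j \<in> I" "x = \<rho> i" "y = \<rho> j"
      using xy J by auto
    moreover from this have "i \<noteq> j" using xy by auto
    ultimately show ?thesis using mem[of i j] mem[of j i] tot[of i j] by blast
  qed
  then have "tournament_on J Q"
    unfolding tournament_on_def using Qsub irrQ fin J by blast
  moreover have "card J = 2 * n + 1"
    using n(1) bij_betw_same_card[OF bij] by simp
  moreover have "\<forall>y\<in>J. card {j. (y, j) \<in> Q} = n \<and> card {j. (j, y) \<in> Q} = n"
    using co ci J by simp
  ultimately have "game_on J Q"
    unfolding game_on_def by (intro conjI exI[of _ n])
  moreover have "game_isomorphic I P J Q"
    unfolding game_isomorphic_def using bij mem by (intro exI[of _ \<rho>]) simp
  ultimately show ?thesis
    unfolding Q_def ..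
qed

lemma game_iso_classes_eq:
  "game_iso_classes I =
     (\<lambda>P. {Q. game_on I Q \<and> game_isomorphic I P I Q}) ` {P. game_on I P}"
  unfolding game_iso_classes_def quotient_def game_iso_rel_def by auto

lemma bij_betw_game_iso_classes:
  fixes I :: "'a set" and J :: "'b set"
  assumes bij: "bij_betw \<rho> I J"
  shows "bij_betw (\<lambda>C. {Q. game_on J Q \<and> (\<exists>P\<in>C. game_isomorphic I P J Q)})
           (game_iso_classes I) (game_iso_classes J)"
proof -
  let ?c = "\<lambda>P. {P'. game_on I P' \<and> game_isomorphic I P I P'}"
  let ?d = "\<lambda>Q. {Q'. game_on J Q' \<and> game_isomorphic J Q J Q'}"
  let ?F = "\<lambda>C. {Q. game_on J Q \<and> (\<exists>P\<in>C. game_isomorphic I P J Q)}"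
  have F: "?F (?c P) = {Q. game_on J Q \<and> game_isomorphic I P J Q}" if "game_on I P" for P
  proof (intro Collect_cong conj_cong refl iffI)
    fix Q assume "game_isomorphic I P J Q"
    then show "\<exists>P'\<in>?c P. game_isomorphic I P' J Q"
      using that game_isomorphic_refl by (intro bexI[of _ P]) simp_all
  next
    fix Q assume "\<exists>P'\<in>?c P. game_isomorphic I P' J Q"
    then show "game_isomorphic I P J Q"
      by (auto intro: game_isomorphic_trans)
  qed
  have Fd: "?F (?c P) = ?d Q" if "game_on I P" "game_isomorphic I P J Q" for P Q
    unfolding F[OF that(1)] by (simp only: game_isomorphic_cong[OF that(2)])
  have to: "\<exists>Q. game_on J Q \<and> game_isomorphic I P J Q" if "game_on I P" for P
    using game_on_transport[OF that bij] by blast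
  have from_J: "\<exists>P. game_on I P \<and> game_isomorphic I P J Q" if "game_on J Q" for Q
    using game_on_transport[OF that bij_betw_inv_into[OF bij]] game_isomorphic_sym by blast
  have c_eq: "?c P = ?c P'" if asm: "game_on I P" "game_on I P'" "?F (?c P) = ?F (?c P')" for P P'
  proof -
    obtain Q where Q: "game_on J Q" "game_isomorphic I P J Q"
      using to[OF asm(1)] by blast
    then have "game_isomorphic I P' J Q"
      using asm(3) unfolding F[OF asm(1)] F[OF asm(2)] by blast
    with Q(2) have iso: "game_isomorphic I P I P'"
      by (rule game_isomorphic_trans[OF _ game_isomorphic_sym])
    show ?thesis
      by (simp only: game_isomorphic_cong[OF iso])
  qed
  show ?thesis
    unfolding bij_betw_def
  proof
    show "inj_on ?F (game_iso_classes I)"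
      unfolding game_iso_classes_eq
    proof (rule inj_onI, elim imageE)
      fix C C' P P'
      assume "?F C = ?F C'" "C = ?c P" "C' = ?c P'" "P \<in> {P. game_on I P}" "P' \<in> {P. game_on I P}"
      then show "C = C'" using c_eq[of P P'] by simp
    qed
    show "?F ` game_iso_classes I = game_iso_classes J"
    proof
      show "?F ` game_iso_classes I \<subseteq> game_iso_classes J"
      proof
        fix D assume "D \<in> ?F ` game_iso_classes I"
        then obtain P where P: "game_on I P" "D = ?F (?c P)"
          unfolding game_iso_classes_eq by blast
        obtain Q where Q: "game_on J Q" "game_isomorphic I P J Q"
          using to[OF P(1)] by blast
        have "D = ?d Q"
          unfolding P(2) by (rule Fd[OF P(1) Q(2)])
        with Q(1) show "D \<in> game_iso_classes J"
          unfolding game_iso_classes_eq by blast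
      qed
      show "game_iso_classes J \<subseteq> ?F ` game_iso_classes I"
      proof
        fix D assume "D \<in> game_iso_classes J"
        then obtain Q where Q: "game_on J Q" "D = ?d Q"
          unfolding game_iso_classes_eq by blast
        obtain P where P: "game_on I P" "game_isomorphic I P J Q"
          using from_J[OF Q(1)] by blast
        have "?c P \<in> game_iso_classes I"
          unfolding game_iso_classes_eq using P(1) by blast
        moreover have "D = ?F (?c P)"
          unfolding Q(2) by (rule Fd[OF P, symmetric])
        ultimately show "D \<in> ?F ` game_iso_classes I"
          by (rule rev_image_eqI)
      qed
    qed
  qed
qed

lemma card_game_iso_classes:
  assumes "card I = 2 * n + 1"
  shows "card (game_iso_classes I) = IS n"
proof -
  have "finite I"
    using assms by (auto intro: card_ge_0_finite)
  then obtain \<rho> where "bij_betw \<rho> I {..<2 * n + 1}"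
    using assms by (metis card_lessThan finite_lessThan finite_same_card_bij)
  then show ?thesis
    unfolding IS_def by (rule bij_betw_same_card[OF bij_betw_game_iso_classes])
qed

end

theory Submission
  imports Defs "HOL-Combinatorics.Permutations"
begin

text \<open>
  Fix a vertex \<open>z\<close> and split the remaining vertices into sets \<open>J\<close>, \<open>K\<close> of size \<open>n\<close>. Any pair of
  tournaments on \<open>J\<close> and \<open>K\<close> extends to a game in which \<open>z\<close> beats exactly \<open>J\<close>: among the
  orientations of the arcs between \<open>J\<close> and \<open>K\<close> choose one minimizing the sum of
  \<open>\<bar>outdegree - n\<bar>\<close>. If it is not regular, consider the set \<open>S\<close> reached along \<open>J\<close>-\<open>K\<close> arcs from a
  vertex of outdegree above \<open>n\<close>. Counting the arcs leaving the vertices of \<open>S\<close> shows that \<open>S\<close>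
  contains a vertex of outdegree below \<open>n\<close>, and reversing a path to it contradicts minimality.

  This yields \<open>2 ^ (n * (n - 1))\<close> games in which \<open>z\<close> beats exactly \<open>J\<close>. An isomorphism class contains
  at most \<open>(2 * n + 1) * (fact n)\<^sup>2\<close> of them, since after fixing which vertex is sent to \<open>z\<close> two
  of them differ by a permutation of \<open>J\<close> and one of \<open>K\<close>.
\<close>

section \<open>Reversing paths in tournaments\<close>

text \<open>\<open>S \<times> S\<close> is the disjoint union of \<open>P\<close>, its converse and
  the diagonal. The additive form avoids halving and truncated subtraction.\<close>

lemma card_tournament:
  assumes "tournament_on S P"
  shows "2 * card P + card S = card S * card S"
proof -
  have fin: "finite S" and sub: "P \<subseteq> S \<times> S" and irr: "\<And>i. (i, i) \<notin> P"
    and tot: "\<And>i j. i \<in> S \<Longrightarrow> j \<in> S \<Longrightarrow> i \<noteq> j \<Longrightarrow> ((i, j) \<in> P) \<noteq> ((j, i) \<in> P)"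
    using assms unfolding tournament_on_def by blast+
  have finP: "finite P"
    using fin sub by (meson finite_SigmaI finite_subset)
  have "S \<times> S = (P \<union> P\<inverse>) \<union> Id_on S"
    using sub tot by (auto simp: Id_on_def)
  then have "card S * card S = card ((P \<union> P\<inverse>) \<union> Id_on S)"
    by (simp flip: card_cartesian_product)
  also have "\<dots> = card (P \<union> P\<inverse>) + card (Id_on S)"
    using finP fin irr by (intro card_Un_disjoint) (auto simp: Id_on_def)
  also have "card (P \<union> P\<inverse>) = card P + card (P\<inverse>)"
  proof (rule card_Un_disjoint)
    show "P \<inter> P\<inverse> = {}"
      using sub tot irr by fast
  qed (use finP in auto)
  also have "card (Id_on S) = card S"
    unfolding Id_on_def by (simp add: UNION_singleton_eq_range card_image inj_on_def)
  finally show ?thesis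
    by (simp add: card_inverse)
qed

lemma tournament_on_Int:
  assumes "tournament_on I P" "S \<subseteq> I"
  shows "tournament_on S (P \<inter> S \<times> S)"
proof -
  have "finite S"
    using assms finite_subset unfolding tournament_on_def by blast
  then show ?thesis
    using assms unfolding tournament_on_def by blast
qed

lemma tournament_on_finite: "tournament_on I P \<Longrightarrow> finite P"
  unfolding tournament_on_def by (meson finite_SigmaI finite_subset)

lemma sum_card_Image:
  assumes "finite P" "finite S"
  shows "(\<Sum>v\<in>S. card (P `` {v})) = card (P \<inter> S \<times> UNIV)"
proof -
  have "P \<inter> S \<times> UNIV = (SIGMA v:S. P `` {v})"
    by auto
  then show ?thesis
    using assms by (simp add: card_SigmaI finite_Image)
qed

text \<open>Loops are cut out: if \<open>u\<close> already occurs on the path from \<open>v\<close>,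
  the suffix starting at \<open>u\<close> is taken instead.\<close>

lemma distinct_path:
  assumes "(u, w) \<in> R\<^sup>*"
  shows "\<exists>xs. distinct xs \<and> xs \<noteq> [] \<and> hd xs = u \<and> last xs = w \<and> successively (\<lambda>x y. (x, y) \<in> R) xs"
  using assms
proof (induction rule: converse_rtrancl_induct)
  case base
  show ?case
    by (intro exI[of _ "[w]"]) simp
next
  case (step u v)
  then obtain xs where xs: "distinct xs" "xs \<noteq> []" "hd xs = v" "last xs = w"
    "successively (\<lambda>x y. (x, y) \<in> R) xs"
    by blast
  show ?case
  proof (cases "u \<in> set xs")
    case True
    then obtain ys zs where split: "xs = ys @ u # zs"
      by (meson split_list)
    have "successively (\<lambda>x y. (x, y) \<in> R) (u # zs)"
      using xs(5) unfolding split successively_append_iff by blast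
    moreover have "distinct (u # zs)" "last (u # zs) = w"
      using xs(1,4) unfolding split by simp_all
    ultimately show ?thesis
      by (intro exI[of _ "u # zs"]) simp
  next
    case False
    moreover have "successively (\<lambda>x y. (x, y) \<in> R) (u # xs)"
      using xs(3,5) step(1) unfolding successively_Cons by simp
    ultimately show ?thesis
      using xs(1,2,4) by (intro exI[of _ "u # xs"]) simp
  qed
qed

lemma reverse_arc:
  assumes P: "tournament_on I P" and xy: "(x, y) \<in> P"
  defines "Q \<equiv> insert (y, x) (P - {(x, y)})"
  shows "tournament_on I Q"
    and "int (card (Q `` {v})) = int (card (P `` {v})) - of_bool (v = x) + of_bool (v = y)"
proof -
  have finI: "finite I" and sub: "P \<subseteq> I \<times> I" and irr: "\<And>i. (i, i) \<notin> P"
    using P unfolding tournament_on_def by blast+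
  then have neq: "x \<noteq> y" and I: "x \<in> I" "y \<in> I"
    using xy by blast+
  have yx: "(y, x) \<notin> P"
    using P xy neq I unfolding tournament_on_def by blast
  show "tournament_on I Q"
    unfolding tournament_on_def
  proof (intro conjI allI ballI impI)
    fix i j assume "i \<in> I" "j \<in> I" "i \<noteq> j"
    then have "((i, j) \<in> P) \<noteq> ((j, i) \<in> P)"
      using P unfolding tournament_on_def by blast
    then show "((i, j) \<in> Q) \<noteq> ((j, i) \<in> Q)"
      using xy yx neq unfolding Q_def by (cases "(i, j) = (x, y)"; cases "(j, i) = (x, y)") auto
  qed (use finI sub irr I neq in \<open>auto simp: Q_def\<close>)
  have fin: "finite (P `` {v})" for v
    using tournament_on_finite[OF P] by (rule finite_Image)
  have out: "Q `` {x} = P `` {x} - {y}" "Q `` {y} = insert x (P `` {y})"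
    "v \<noteq> x \<Longrightarrow> v \<noteq> y \<Longrightarrow> Q `` {v} = P `` {v}" for v
    using neq unfolding Q_def by auto
  have "card (P `` {x}) > 0"
    using xy fin[of x] by (auto simp: card_gt_0_iff)
  moreover have "card (Q `` {x}) = card (P `` {x}) - 1"
    unfolding out(1) using xy by (intro card_Diff_singleton) simp
  moreover have "card (Q `` {y}) = card (P `` {y}) + 1"
    unfolding out(2) using yx fin by (subst card_insert_disjoint) auto
  ultimately show "int (card (Q `` {v})) = int (card (P `` {v})) - of_bool (v = x) + of_bool (v = y)"
    using neq out(3)[of v] by (cases "v = x"; cases "v = y") auto
qed

text \<open>The arcs are reversed one after another. An interior vertex gains one output and loses
  one, so only the endpoints change. Distinctness keeps the rest of the path intact after the first
  reversal; symmetry of \<open>F\<close> keeps every reversed arc in \<open>F\<close>. For a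
  one-vertex path the two corrections cancel.\<close>

lemma reverse_path:
  assumes "sym F" "tournament_on I P" "distinct xs" "xs \<noteq> []"
    "successively (\<lambda>x y. (x, y) \<in> P \<inter> F) xs"
  shows "\<exists>Q. tournament_on I Q \<and> Q - F = P - F \<and>
    (\<forall>v. int (card (Q `` {v})) = int (card (P `` {v})) - of_bool (v = hd xs) + of_bool (v = last xs))"
  using assms
proof (induction xs arbitrary: P)
  case Nil
  then show ?case by simp
next
  case (Cons x xs)
  show ?case
  proof (cases xs)
    case Nil
    with Cons.prems show ?thesis
      by (intro exI[of _ P]) simp
  next
    case (Cons y ys)
    have xy: "(x, y) \<in> P" "(x, y) \<in> F" "(y, x) \<in> F"
      using Cons.prems Cons by (auto dest: symD)
    define P1 where "P1 = insert (y, x) (P - {(x, y)})"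
    note P1 = reverse_arc[OF Cons.prems(2) xy(1), folded P1_def]
    have "successively (\<lambda>x y. (x, y) \<in> P1 \<inter> F) xs"
    proof (rule successively_mono)
      show "successively (\<lambda>x y. (x, y) \<in> P \<inter> F) xs"
        using Cons.prems(5) Cons by simp
    qed (use Cons.prems(3) in \<open>auto simp: P1_def\<close>)
    then obtain Q where Q: "tournament_on I Q" "Q - F = P1 - F"
      "\<And>v. int (card (Q `` {v})) = int (card (P1 `` {v})) - of_bool (v = hd xs) + of_bool (v = last xs)"
      using Cons.IH[OF Cons.prems(1) P1(1)] Cons.prems(3) Cons by auto
    have "P1 - F = P - F"
      using xy unfolding P1_def by auto
    with Q P1(2) Cons show ?thesis
      by (intro exI[of _ Q]) auto
  qed
qed

text \<open>\<open>F\<close> marks the pairs whose orientation may change, and \<open>bound\<close>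
  is a cut condition in the style of Hall: a set left by no arc in \<open>F\<close> has average
  outdegree at most \<open>n\<close>. Hence a vertex of surplus always reaches one of
  deficit.\<close>

lemma exists_regular_reorientation:
  fixes I :: "'a set"
  assumes P: "tournament_on I P" and F: "sym F" and card_I: "card I = 2 * n + 1"
    and bound: "\<And>Q S. tournament_on I Q \<Longrightarrow> Q - F = P - F \<Longrightarrow> S \<subseteq> I \<Longrightarrow> (Q \<inter> F) `` S \<subseteq> S \<Longrightarrow>
      card (Q \<inter> S \<times> UNIV) \<le> n * card S"
  shows "\<exists>Q. game_on I Q \<and> Q - F = P - F"
proof -
  \<comment> \<open>The total deviation from regularity, turned into a natural number so that a
    minimizer exists.\<close>
  define D where "D = (\<lambda>Q :: 'a rel. nat (\<Sum>v\<in>I. \<bar>int (card (Q `` {v})) - int n\<bar>))"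
  define ok where "ok = (\<lambda>Q. tournament_on I Q \<and> Q - F = P - F)"
  have "ok P"
    unfolding ok_def using P by simp
  then obtain Q where "ok Q" and min: "\<And>R. ok R \<Longrightarrow> D Q \<le> D R"
    using ex_has_least_nat[of ok P D] by blast
  then have Q: "tournament_on I Q" "Q - F = P - F"
    unfolding ok_def by auto
  define d where "d = (\<lambda>v. int (card (Q `` {v})) - int n)"
  have finI: "finite I" and sub: "Q \<subseteq> I \<times> I" and irr: "\<And>i. (i, i) \<notin> Q"
    and tot: "\<And>i j. i \<in> I \<Longrightarrow> j \<in> I \<Longrightarrow> i \<noteq> j \<Longrightarrow> ((i, j) \<in> Q) \<noteq> ((j, i) \<in> Q)"
    using Q(1) unfolding tournament_on_def by blast+
  note finQ = tournament_on_finite[OF Q(1)]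
  have sum_d: "sum d S = int (card (Q \<inter> S \<times> UNIV)) - int n * int (card S)" if "S \<subseteq> I" for S
  proof -
    have "finite S"
      using that finI finite_subset by blast
    then have "int (\<Sum>v\<in>S. card (Q `` {v})) = int (card (Q \<inter> S \<times> UNIV))"
      using sum_card_Image[OF finQ] by simp
    then show ?thesis
      unfolding d_def by (simp add: sum_subtractf mult.commute)
  qed
  have "card Q = n * (2 * n + 1)"
    using card_tournament[OF Q(1)] unfolding card_I by (simp add: algebra_simps)
  moreover have "Q \<inter> I \<times> UNIV = Q"
    using sub by auto
  ultimately have sum_0: "sum d I = 0"
    using sum_d[of I] card_I by (simp add: distrib_left)
  have d_le: "d u \<le> 0" if "u \<in> I" for u
  proof (rule ccontr)
    assume pos: "\<not> d u \<le> 0"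
    define S where "S = (Q \<inter> F)\<^sup>* `` {u}"
    have uS: "u \<in> S"
      unfolding S_def by auto
    have SI: "S \<subseteq> I"
    proof
      fix w assume "w \<in> S"
      then have "(u, w) \<in> (Q \<inter> F)\<^sup>*"
        unfolding S_def by auto
      then show "w \<in> I"
        using \<open>u \<in> I\<close> sub by (induction rule: rtrancl_induct) auto
    qed
    have "(Q \<inter> F) `` S \<subseteq> S"
      unfolding S_def by (meson Image_closed_trancl rtrancl_into_rtrancl ImageE ImageI subsetI)
    then have "card (Q \<inter> S \<times> UNIV) \<le> n * card S"
      using bound Q SI by blast
    then have "sum d S \<le> 0"
      unfolding sum_d[OF SI] by (metis diff_le_0_iff_le of_nat_le_iff of_nat_mult)
    moreover have "finite S"
      using SI finI finite_subset by blast
    \<comment> \<open>The sum over \<open>S\<close> is at most zero while \<open>u\<close>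
      contributes a positive term, so some other term is negative.\<close>
    ultimately obtain w where w: "w \<in> S" "d w < 0"
      using pos uS sum_pos2[of S u d] by (meson not_le)
    then have "(u, w) \<in> (Q \<inter> F)\<^sup>*"
      unfolding S_def by auto
    from distinct_path[OF this] obtain xs where xs: "distinct xs" "xs \<noteq> []" "hd xs = u" "last xs = w"
      "successively (\<lambda>x y. (x, y) \<in> Q \<inter> F) xs"
      by (elim exE conjE)
    obtain R where R: "tournament_on I R" "R - F = Q - F"
      "\<And>v. int (card (R `` {v})) = int (card (Q `` {v})) - of_bool (v = u) + of_bool (v = w)"
      using reverse_path[OF F Q(1) xs(1,2,5)] xs(3,4) by auto
    have "ok R"
      using R Q unfolding ok_def by simp
    then have "D Q \<le> D R"
      by (rule min)
    then have le: "(\<Sum>v\<in>I. \<bar>int (card (Q `` {v})) - int n\<bar>) \<le> (\<Sum>v\<in>I. \<bar>int (card (R `` {v})) - int n\<bar>)"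
      unfolding D_def by (simp add: nat_le_eq_zle sum_nonneg)
    \<comment> \<open>One unit passes from surplus to deficit: since \<open>d u \<ge> 1\<close> and
      \<open>d w \<le> -1\<close>, both absolute values drop by one and no other term
      changes.\<close>
    have "(\<Sum>v\<in>I. \<bar>int (card (R `` {v})) - int n\<bar>) < (\<Sum>v\<in>I. \<bar>int (card (Q `` {v})) - int n\<bar>)"
    proof (rule sum_strict_mono_ex1[OF finI])
      show "\<forall>v\<in>I. \<bar>int (card (R `` {v})) - int n\<bar> \<le> \<bar>int (card (Q `` {v})) - int n\<bar>"
      proof
        fix v
        show "\<bar>int (card (R `` {v})) - int n\<bar> \<le> \<bar>int (card (Q `` {v})) - int n\<bar>"
          using R(3)[of v] pos w unfolding d_def by (cases "v = u"; cases "v = w") simp_all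
      qed
      show "\<exists>v\<in>I. \<bar>int (card (R `` {v})) - int n\<bar> < \<bar>int (card (Q `` {v})) - int n\<bar>"
        using R(3)[of u] pos w \<open>u \<in> I\<close> unfolding d_def by (intro bexI[of _ u]) auto
    qed
    with le show False by simp
  qed
  have d0: "d v = 0" if "v \<in> I" for v
    using sum_nonneg_eq_0_iff[OF finI, of "\<lambda>v. - d v"] d_le sum_0 that by (simp add: sum_negf)
  have out: "card {j. (v, j) \<in> Q} = n" if "v \<in> I" for v
    using d0[OF that] unfolding d_def by (simp add: Image_singleton)
  moreover have "card {j. (j, v) \<in> Q} = n" if v: "v \<in> I" for v
  proof -
    have "{j. (j, v) \<in> Q} = I - {v} - {j. (v, j) \<in> Q}"
      using sub irr tot[OF v] by blast
    also have "card \<dots> = card (I - {v}) - n"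
      using out[OF v] sub irr finI
      by (subst card_Diff_subset) (auto intro: finite_subset[of _ I])
    finally show ?thesis
      using v finI card_I by simp
  qed
  ultimately have "game_on I Q"
    unfolding game_on_def using Q(1) card_I by (intro conjI exI[of _ n] ballI)
  with Q(2) show ?thesis by blast
qed

section \<open>Completing two tournaments to a game\<close>

text \<open>This supplies the cut condition when the free arcs are those between \<open>J\<close>
  and \<open>K\<close>. Arcs inside \<open>S\<close> are counted as in a tournament, and closedness
  leaves few ways out of \<open>S\<close>.\<close>

lemma closed_set_bound:
  assumes Q: "tournament_on I Q" and I: "I = insert z (J \<union> K)"
    and disj: "z \<notin> J" "z \<notin> K" "J \<inter> K = {}" and card: "card J = n" "card K = n"
    and z: "Q `` {z} = J"
    and SI: "S \<subseteq> I" and closed: "(Q \<inter> (J \<times> K \<union> K \<times> J)) `` S \<subseteq> S"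
  shows "card (Q \<inter> S \<times> UNIV) \<le> n * card S"
proof -
  define A B T where "A = S \<inter> J" and "B = S \<inter> K" and "T = A \<union> B"
  have finI: "finite I" and sub: "Q \<subseteq> I \<times> I"
    and tot: "\<And>i j. i \<in> I \<Longrightarrow> j \<in> I \<Longrightarrow> i \<noteq> j \<Longrightarrow> ((i, j) \<in> Q) \<noteq> ((j, i) \<in> Q)"
    using Q unfolding tournament_on_def by blast+
  have fin: "finite J" "finite K" "finite A" "finite B" "finite T"
    using finI I unfolding A_def B_def T_def by auto
  note finQ = tournament_on_finite[OF Q]
  have TI: "T \<subseteq> I"
    using SI unfolding A_def B_def T_def by auto
  have cT: "card T = card A + card B"
    using fin disj unfolding T_def by (intro card_Un_disjoint) (auto simp: A_def B_def)
  have Jz: "(j, z) \<notin> Q" if "j \<in> J" for j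
    using tot[of z j] z that I disj by auto
  \<comment> \<open>Arcs between \<open>J\<close> and \<open>K\<close> cannot leave
    \<open>S\<close>, so an arc leaving \<open>T\<close> stays within \<open>J\<close>, stays within
    \<open>K\<close>, or goes to \<open>z\<close>. The last must start in \<open>K\<close>, because
    \<open>z\<close> beats all of \<open>J\<close>.\<close>
  have "Q \<inter> T \<times> UNIV \<subseteq> (Q \<inter> T \<times> T) \<union> A \<times> (J - A) \<union> B \<times> (K - B) \<union> B \<times> {z}"
  proof (rule subrelI)
    fix x y assume "(x, y) \<in> Q \<inter> T \<times> UNIV"
    then have xy: "(x, y) \<in> Q" "x \<in> T" "y \<in> I"
      using sub by auto
    then show "(x, y) \<in> (Q \<inter> T \<times> T) \<union> A \<times> (J - A) \<union> B \<times> (K - B) \<union> B \<times> {z}"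
      using closed Jz I unfolding A_def B_def T_def by blast
  qed
  then have "card (Q \<inter> T \<times> UNIV) \<le> card ((Q \<inter> T \<times> T) \<union> A \<times> (J - A) \<union> B \<times> (K - B) \<union> B \<times> {z})"
    using fin by (intro card_mono) auto
  also have "\<dots> \<le> card (Q \<inter> T \<times> T) + card (A \<times> (J - A)) + card (B \<times> (K - B)) + card (B \<times> {z})"
    by (meson add_le_mono card_Un_le le_refl order_trans)
  also have "\<dots> = card (Q \<inter> T \<times> T) + card A * (n - card A) + card B * (n - card B) + card B"
    using fin card by (simp add: card_cartesian_product card_Diff_subset A_def B_def)
  finally have le: "card (Q \<inter> T \<times> UNIV) \<le> \<dots>" .
  have inner: "2 * card (Q \<inter> T \<times> T) + card T = card T * card T"
    by (rule card_tournament[OF tournament_on_Int[OF Q TI]])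
  have AB: "card A \<le> n" "card B \<le> n"
    using fin card card_mono[of J A] card_mono[of K B] unfolding A_def B_def by auto
  define a b e where "a = int (card A)" and "b = int (card B)" and "e = int (card (Q \<inter> T \<times> T))"
  have "2 * e + (a + b) = (a + b) * (a + b)"
    using arg_cong[OF inner, of int] unfolding cT a_def b_def e_def by simp
  moreover have "int (card (Q \<inter> T \<times> UNIV)) \<le> e + a * (int n - a) + b * (int n - b) + b"
    using le AB unfolding a_def b_def e_def
    by (metis (mono_tags, lifting) of_nat_add of_nat_diff of_nat_le_iff of_nat_mult)
  \<comment> \<open>Eliminating \<open>e\<close>, the claim is that \<open>d * d + d \<ge> 0\<close> for the integer \<open>d = a - b\<close>.\<close>
  moreover have "(a - b) * (a - b) + (a - b) \<ge> 0"
  proof (cases "a - b \<ge> 0")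
    case False
    then have "(a - b) * (a - b + 1) \<ge> 0"
      by (intro mult_nonpos_nonpos) auto
    then show ?thesis by (simp add: algebra_simps)
  qed simp
  ultimately have "int (card (Q \<inter> T \<times> UNIV)) \<le> int n * (a + b)"
    by (simp add: algebra_simps)
  then have T: "card (Q \<inter> T \<times> UNIV) \<le> n * card T"
    unfolding cT a_def b_def by (metis of_nat_add of_nat_le_iff of_nat_mult)
  show ?thesis
  \<comment> \<open>Adding \<open>z\<close> raises both sides by exactly \<open>n\<close>, its
    outdegree being \<open>card J\<close>.\<close>
  proof (cases "z \<in> S")
    case False
    then have "S = T"
      using SI I unfolding A_def B_def T_def by auto
    with T show ?thesis by simp
  next
    case True
    then have S: "S = insert z T"
      using SI I unfolding A_def B_def T_def by auto
    have zT: "z \<notin> T"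
      using disj unfolding A_def B_def T_def by auto
    have "(\<Sum>v\<in>S. card (Q `` {v})) = card (Q `` {z}) + (\<Sum>v\<in>T. card (Q `` {v}))"
      unfolding S using zT fin by simp
    then have "card (Q \<inter> S \<times> UNIV) = n + card (Q \<inter> T \<times> UNIV)"
      using fin S z card by (simp add: sum_card_Image[OF finQ])
    with T show ?thesis
      unfolding S using zT fin by simp
  qed
qed

definition pointed_games :: "'a set \<Rightarrow> 'a \<Rightarrow> 'a set \<Rightarrow> 'a rel set" where
  "pointed_games I z J = {P. game_on I P \<and> P `` {z} = J}"

lemma game_on_subset: "game_on I P \<Longrightarrow> P \<subseteq> I \<times> I"
  unfolding game_on_def tournament_on_def by blast

lemma finite_pointed_games:
  assumes "finite I"
  shows "finite (pointed_games I z J)"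
proof (rule finite_subset)
  show "pointed_games I z J \<subseteq> Pow (I \<times> I)"
    using game_on_subset unfolding pointed_games_def by blast
qed (use assms in auto)

text \<open>The strict order on \<open>A\<close> is itself a tournament.\<close>

lemma card_less_pairs:
  fixes A :: "'a::linorder set"
  assumes "finite A"
  shows "2 * card {(i, j). i \<in> A \<and> j \<in> A \<and> i < j} + card A = card A * card A"
  using assms by (intro card_tournament) (auto simp: tournament_on_def)

text \<open>Each pair \<open>i < j\<close> inside \<open>J\<close> or inside \<open>K\<close> is one
  free bit, and the order merely names one arc per unordered pair. Every choice \<open>Y\<close> of
  bits is recovered from its game as \<open>Q \<inter> X\<close>, so different choices give
  different games.\<close>

lemma card_pointed_games_ge:
  fixes I :: "'a::linorder set"
  assumes finI: "finite I" and I: "I = insert z (J \<union> K)"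
    and disj: "z \<notin> J" "z \<notin> K" "J \<inter> K = {}" and card: "card J = n" "card K = n"
  shows "2 ^ (n * (n - 1)) \<le> card (pointed_games I z J)"
proof -
  define F where "F = J \<times> K \<union> K \<times> J"
  define pairs where "pairs = (\<lambda>A :: 'a set. {(i, j). i \<in> A \<and> j \<in> A \<and> i < j})"
  define X where "X = pairs J \<union> pairs K"
  have fin: "finite J" "finite K"
    using finI I by auto
  have finp: "finite (pairs A)" if "finite A" for A
    by (rule finite_subset[of _ "A \<times> A"]) (use that in \<open>auto simp: pairs_def\<close>)
  have "2 * card (pairs J) + n = n * n" "2 * card (pairs K) + n = n * n"
    using card_less_pairs[OF fin(1)] card_less_pairs[OF fin(2)] card unfolding pairs_def by simp_all
  moreover have "card X = card (pairs J) + card (pairs K)"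
    unfolding X_def using fin finp disj by (intro card_Un_disjoint) (auto simp: pairs_def)
  ultimately have cX: "card X = n * (n - 1)"
    by (simp add: right_diff_distrib')
  have finX: "finite X"
    unfolding X_def using fin finp by simp
  have card_I: "card I = 2 * n + 1"
    using fin disj card unfolding I by (simp add: card_Un_disjoint)
  have XF: "X \<inter> F = {}"
    using disj unfolding X_def F_def pairs_def by auto
  have ex: "\<exists>Q. Q \<in> pointed_games I z J \<and> Q \<inter> X = Y" if Y: "Y \<subseteq> X" for Y
  proof -
    \<comment> \<open>The starting tournament: \<open>z\<close> beats \<open>J\<close> and loses to
      \<open>K\<close>, and \<open>Y\<close> decides the arcs inside \<open>J\<close> and
      \<open>K\<close>. Between \<open>J\<close> and \<open>K\<close> the larger vertex wins, an
      arbitrary choice that the reorientation revises.\<close>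
    define P where "P = {(i, j). i \<in> I \<and> j \<in> I \<and> i \<noteq> j \<and>
      (if i = z then j \<in> J else if j = z then i \<in> K else if i < j then (i, j) \<in> Y else (j, i) \<notin> Y)}"
    have P: "tournament_on I P"
      using finI disj unfolding tournament_on_def P_def I by auto
    have PX: "P \<inter> X = Y"
    proof -
      have "X \<subseteq> I \<times> I" "\<And>i j. (i, j) \<in> X \<Longrightarrow> i < j \<and> i \<noteq> z \<and> j \<noteq> z"
        using disj unfolding X_def pairs_def I by auto
      then show ?thesis
        using Y unfolding P_def by auto
    qed
    have Pz: "P `` {z} = J"
      using disj unfolding P_def I by auto
    \<comment> \<open>No pair in \<open>F\<close> involves \<open>z\<close>.\<close>
    have keep: "Q `` {z} = J" if "Q - F = P - F" for Q
      using that Pz disj unfolding F_def by blast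
    have "\<exists>Q. game_on I Q \<and> Q - F = P - F"
    proof (rule exists_regular_reorientation[OF P _ card_I])
      show "sym F"
        unfolding F_def sym_def by auto
      fix Q S assume "tournament_on I Q" "Q - F = P - F" "S \<subseteq> I" "(Q \<inter> F) `` S \<subseteq> S"
      then show "card (Q \<inter> S \<times> UNIV) \<le> n * card S"
        using closed_set_bound[OF _ I disj card keep] unfolding F_def by blast
    qed
    then obtain Q where Q: "game_on I Q" "Q - F = P - F"
      by blast
    then have "Q \<inter> X = Y"
      using PX XF by blast
    with Q keep show ?thesis
      unfolding pointed_games_def by blast
  qed
  have "Pow X \<subseteq> (\<lambda>Q. Q \<inter> X) ` pointed_games I z J"
    using ex by blast
  then have "card (Pow X) \<le> card (pointed_games I z J)"
    using finite_pointed_games[OF finI] by (meson card_image_le card_mono finite_imageI le_trans)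
  then show ?thesis
    using cX finX by (simp add: card_Pow)
qed

section \<open>Counting pointed games in an isomorphism class\<close>

text \<open>An isomorphism determines its target relation completely, so counting games reduces to
  counting bijections.\<close>

lemma iso_image:
  assumes bij: "bij_betw \<rho> I J" and P: "P \<subseteq> I \<times> I" and Q: "Q \<subseteq> J \<times> J"
    and iso: "\<forall>i\<in>I. \<forall>j\<in>I. (i, j) \<in> P \<longleftrightarrow> (\<rho> i, \<rho> j) \<in> Q"
  shows "map_prod \<rho> \<rho> ` P = Q"
proof
  show "map_prod \<rho> \<rho> ` P \<subseteq> Q"
  proof (rule image_subsetI)
    fix e assume "e \<in> P"
    then obtain i j where "e = (i, j)" "(i, j) \<in> P" "i \<in> I" "j \<in> I"
      using P by blast
    with iso show "map_prod \<rho> \<rho> e \<in> Q" by simp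
  qed
  show "Q \<subseteq> map_prod \<rho> \<rho> ` P"
  proof (rule subrelI)
    fix x y assume xy: "(x, y) \<in> Q"
    then obtain i j where "i \<in> I" "j \<in> I" "x = \<rho> i" "y = \<rho> j"
      using Q bij unfolding bij_betw_def by blast
    moreover from this have "(i, j) \<in> P"
      using xy iso by simp
    ultimately show "(x, y) \<in> map_prod \<rho> \<rho> ` P"
      by (intro image_eqI[of _ _ "(i, j)"]) simp_all
  qed
qed

text \<open>An isomorphism fixing \<open>z\<close> preserves its set of outputs \<open>J\<close>,
  hence also \<open>K\<close>. Its restrictions to \<open>J\<close> and \<open>K\<close>, extended
  by the identity, are the two permutations; outside \<open>I\<close> their composite may differ
  from \<open>\<tau>\<close>, which does not affect the image of \<open>P\<close>.\<close>

lemma pointed_iso_decompose: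
  assumes I: "I = insert z (J \<union> K)" and disj: "z \<notin> J" "z \<notin> K" "J \<inter> K = {}"
    and P: "P \<in> pointed_games I z J" and Q: "Q \<in> pointed_games I z J"
    and bij: "bij_betw \<tau> I I" and \<tau>z: "\<tau> z = z"
    and iso: "\<forall>i\<in>I. \<forall>j\<in>I. (i, j) \<in> P \<longleftrightarrow> (\<tau> i, \<tau> j) \<in> Q"
  shows "\<exists>p q. p permutes J \<and> q permutes K \<and> Q = map_prod (p \<circ> q) (p \<circ> q) ` P"
proof -
  have PI: "P \<subseteq> I \<times> I" and QI: "Q \<subseteq> I \<times> I" and Pz: "P `` {z} = J" and Qz: "Q `` {z} = J"
    using P Q game_on_subset unfolding pointed_games_def by blast+
  have inj: "inj_on \<tau> I" and im: "\<tau> ` I = I"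
    using bij unfolding bij_betw_def by auto
  have mem: "\<tau> i \<in> J \<longleftrightarrow> i \<in> J" if "i \<in> I" for i
    using iso Pz Qz \<tau>z that I by (metis Image_singleton_iff insertI1)
  have imJ: "\<tau> ` J = J"
  proof
    show "\<tau> ` J \<subseteq> J"
      using mem I by auto
    show "J \<subseteq> \<tau> ` J"
    proof
      fix y assume y: "y \<in> J"
      then obtain x where "x \<in> I" "y = \<tau> x"
        using im I by (metis UnI1 imageE insertI2)
      with y mem show "y \<in> \<tau> ` J" by auto
    qed
  qed
  have K: "K = I - insert z J"
    using I disj by auto
  have "\<tau> ` K = \<tau> ` I - \<tau> ` insert z J"
    unfolding K by (rule inj_on_image_set_diff[OF inj]) (use I in auto)
  also have "\<dots> = K"
    unfolding K image_insert im imJ \<tau>z ..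
  finally have imK: "\<tau> ` K = K" .
  define p where "p = (\<lambda>x. if x \<in> J then \<tau> x else x)"
  define q where "q = (\<lambda>x. if x \<in> K then \<tau> x else x)"
  have "p permutes J"
  proof (rule bij_imp_permutes)
    show "bij_betw p J J"
      using inj imJ I unfolding bij_betw_def p_def by (auto simp: inj_on_def)
  qed (simp add: p_def)
  moreover have "q permutes K"
  proof (rule bij_imp_permutes)
    show "bij_betw q K K"
      using inj imK I unfolding bij_betw_def q_def by (auto simp: inj_on_def)
  qed (simp add: q_def)
  moreover have "(p \<circ> q) x = \<tau> x" if "x \<in> I" for x
    using that disj imJ imK \<tau>z I unfolding p_def q_def by auto
  then have "map_prod (p \<circ> q) (p \<circ> q) ` P = map_prod \<tau> \<tau> ` P"
    using PI by (intro image_cong) auto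
  with iso_image[OF bij PI QI iso] have "Q = map_prod (p \<circ> q) (p \<circ> q) ` P"
    by simp
  ultimately show ?thesis by blast
qed

text \<open>With one member \<open>Q0\<close> as reference, every member is the image of
  \<open>Q0\<close> under a permutation of \<open>J\<close> composed with one of
  \<open>K\<close>.\<close>

lemma card_pointed_iso_le:
  assumes finI: "finite I" and I: "I = insert z (J \<union> K)" and disj: "z \<notin> J" "z \<notin> K" "J \<inter> K = {}"
    and card: "card J = n" "card K = n" and v: "v \<in> I"
  shows "card {Q \<in> pointed_games I z J. \<exists>\<rho>. bij_betw \<rho> I I \<and> \<rho> v = z \<and>
    (\<forall>i\<in>I. \<forall>j\<in>I. (i, j) \<in> P \<longleftrightarrow> (\<rho> i, \<rho> j) \<in> Q)} \<le> (fact n)\<^sup>2" (is "card ?C \<le> _")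
proof (cases "?C = {}")
  case True
  then show ?thesis
    by (metis card.empty zero_le)
next
  case False
  then obtain Q0 \<rho>0 where Q0: "Q0 \<in> pointed_games I z J" "bij_betw \<rho>0 I I" "\<rho>0 v = z"
    "\<forall>i\<in>I. \<forall>j\<in>I. (i, j) \<in> P \<longleftrightarrow> (\<rho>0 i, \<rho>0 j) \<in> Q0"
    by blast
  have fin: "finite J" "finite K"
    using finI I by auto
  let ?PP = "{p. p permutes J} \<times> {q. q permutes K}"
  let ?f = "\<lambda>(p, q). map_prod (p \<circ> q) (p \<circ> q) ` Q0"
  have finPP: "finite ?PP"
    using fin by (simp add: finite_permutations)
  have "?C \<subseteq> ?f ` ?PP"
  proof
    fix Q assume "Q \<in> ?C"
    then obtain \<rho> where Q: "Q \<in> pointed_games I z J" "bij_betw \<rho> I I" "\<rho> v = z"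
      "\<forall>i\<in>I. \<forall>j\<in>I. (i, j) \<in> P \<longleftrightarrow> (\<rho> i, \<rho> j) \<in> Q"
      by blast
    \<comment> \<open>Both \<open>\<rho>0\<close> and \<open>\<rho>\<close> send \<open>v\<close> to
      \<open>z\<close>, so passing back along \<open>\<rho>0\<close> and on along
      \<open>\<rho>\<close> fixes \<open>z\<close> and carries \<open>Q0\<close> to
      \<open>Q\<close>.\<close>
    define \<tau> where "\<tau> = \<rho> \<circ> inv_into I \<rho>0"
    note inv = bij_betw_inv_into[OF Q0(2)]
    have bij: "bij_betw \<tau> I I"
      unfolding \<tau>_def using inv Q(2) by (rule bij_betw_trans)
    have z: "\<tau> z = z"
      unfolding \<tau>_def using bij_betw_inv_into_left[OF Q0(2) v] Q0(3) Q(3) by simp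
    have "\<forall>i\<in>I. \<forall>j\<in>I. (i, j) \<in> Q0 \<longleftrightarrow> (\<tau> i, \<tau> j) \<in> Q"
    proof (intro ballI)
      fix i j assume ij: "i \<in> I" "j \<in> I"
      then have "inv_into I \<rho>0 i \<in> I" "inv_into I \<rho>0 j \<in> I"
        using inv by (auto dest: bij_betwE)
      then show "(i, j) \<in> Q0 \<longleftrightarrow> (\<tau> i, \<tau> j) \<in> Q"
        using Q0(4) Q(4) ij bij_betw_inv_into_right[OF Q0(2)] unfolding \<tau>_def by simp
    qed
    then obtain p q where "p permutes J" "q permutes K" "Q = map_prod (p \<circ> q) (p \<circ> q) ` Q0"
      using pointed_iso_decompose[OF I disj Q0(1) Q(1) bij z] by blast
    then show "Q \<in> ?f ` ?PP"
      by (intro image_eqI[of _ _ "(p, q)"]) auto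
  qed
  then have "card ?C \<le> card ?PP"
    using finPP by (meson card_image_le card_mono finite_imageI le_trans)
  also have "\<dots> = (fact n)\<^sup>2"
    using fin card by (simp add: card_cartesian_product card_permutations power2_eq_square)
  finally show ?thesis .
qed

text \<open>The games are sorted by the vertex \<open>v\<close> of the representative
  \<open>P\<close> that is sent to \<open>z\<close>, which leaves \<open>2 * n + 1\<close>
  cases.\<close>

lemma card_class_pointed_games_le:
  assumes finI: "finite I" and I: "I = insert z (J \<union> K)" and disj: "z \<notin> J" "z \<notin> K" "J \<inter> K = {}"
    and card: "card J = n" "card K = n" and C: "C \<in> game_iso_classes I"
  shows "card (C \<inter> pointed_games I z J) \<le> (2 * n + 1) * (fact n)\<^sup>2"
proof -
  obtain P where P: "C = {Q. game_on I Q \<and> game_isomorphic I P I Q}"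
    using C unfolding game_iso_classes_eq by blast
  define X where "X = (\<lambda>v. {Q \<in> pointed_games I z J. \<exists>\<rho>. bij_betw \<rho> I I \<and> \<rho> v = z \<and>
    (\<forall>i\<in>I. \<forall>j\<in>I. (i, j) \<in> P \<longleftrightarrow> (\<rho> i, \<rho> j) \<in> Q)})"
  have card_I: "card I = 2 * n + 1"
    using finI disj card unfolding I by (simp add: card_Un_disjoint)
  have "C \<inter> pointed_games I z J \<subseteq> (\<Union>v\<in>I. X v)"
  proof
    fix Q assume "Q \<in> C \<inter> pointed_games I z J"
    then obtain \<rho> where Q: "Q \<in> pointed_games I z J" "bij_betw \<rho> I I"
      "\<forall>i\<in>I. \<forall>j\<in>I. (i, j) \<in> P \<longleftrightarrow> (\<rho> i, \<rho> j) \<in> Q"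
      unfolding P game_isomorphic_def by blast
    obtain v where "v \<in> I" "\<rho> v = z"
      using Q(2) I by (metis bij_betw_imp_surj_on imageE insertI1)
    with Q show "Q \<in> (\<Union>v\<in>I. X v)"
      unfolding X_def by blast
  qed
  moreover have "finite (\<Union>v\<in>I. X v)"
    using finI finite_pointed_games[OF finI] unfolding X_def by auto
  ultimately have "card (C \<inter> pointed_games I z J) \<le> card (\<Union>v\<in>I. X v)"
    by (rule card_mono[rotated])
  also have "\<dots> \<le> (\<Sum>v\<in>I. card (X v))"
    using finI by (rule card_UN_le)
  also have "\<dots> \<le> (\<Sum>v\<in>I. (fact n)\<^sup>2)"
    unfolding X_def by (intro sum_mono card_pointed_iso_le[OF finI I disj card])
  finally show ?thesis
    using card_I by simp
qed

section \<open>Lower bounds for the number of isomorphism classes\<close>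

lemma IS_mult_ge: "2 ^ (n * (n - 1)) \<le> IS n * ((2 * n + 1) * (fact n)\<^sup>2)"
proof -
  define I where "I = {..<2 * n + 1}"
  define J where "J = {1..n}"
  define K where "K = {n + 1..2 * n}"
  have finI: "finite I" and I: "I = insert 0 (J \<union> K)" and disj: "0 \<notin> J" "0 \<notin> K" "J \<inter> K = {}"
    and card: "card J = n" "card K = n"
    unfolding I_def J_def K_def by auto
  let ?G = "pointed_games I 0 J"
  have "{P. game_on I P} \<subseteq> Pow (I \<times> I)"
    using game_on_subset by blast
  then have "finite {P. game_on I P}"
    using finI by (meson finite_Pow_iff finite_SigmaI finite_subset)
  then have fin: "finite (game_iso_classes I)"
    unfolding game_iso_classes_eq by simp
  have "2 ^ (n * (n - 1)) \<le> card ?G"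
    by (rule card_pointed_games_ge[OF finI I disj card])
  also have "\<dots> \<le> card (\<Union>C\<in>game_iso_classes I. C \<inter> ?G)"
  proof (rule card_mono)
    show "finite (\<Union>C\<in>game_iso_classes I. C \<inter> ?G)"
      using fin finite_pointed_games[OF finI] by auto
    \<comment> \<open>Each pointed game lies in its own class.\<close>
    show "?G \<subseteq> (\<Union>C\<in>game_iso_classes I. C \<inter> ?G)"
      using game_isomorphic_refl unfolding game_iso_classes_eq pointed_games_def by blast
  qed
  also have "\<dots> \<le> (\<Sum>C\<in>game_iso_classes I. card (C \<inter> ?G))"
    using fin by (rule card_UN_le)
  also have "\<dots> \<le> (\<Sum>C\<in>game_iso_classes I. (2 * n + 1) * (fact n)\<^sup>2)"
    by (intro sum_mono card_class_pointed_games_le[OF finI I disj card])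
  also have "\<dots> = IS n * ((2 * n + 1) * (fact n)\<^sup>2)"
    unfolding IS_def I_def by simp
  finally show ?thesis .
qed

text \<open>In the induction step the right side grows by a factor of at least
  \<open>3 * (Suc n)\<^sup>2\<close>, by Bernoulli, and the left side by at most that. The factor
  \<open>2 ^ n\<close> is the gap between the exponents \<open>n * n\<close> and
  \<open>n * (n - 1)\<close> in the logarithmic bound.\<close>

lemma fact_square_bound:
  assumes "n \<ge> 7"
  shows "real (2 * n + 1) * (fact n)\<^sup>2 * 2 ^ n \<le> real n ^ (2 * n)"
  using assms
proof (induction n rule: nat_induct_at_least)
  case base
  show ?case by (simp add: fact_numeral)
next
  case (Suc n)
  have n: "real n > 0"
    using Suc by simp
  have "3 = 1 + real (2 * n) * (1 / real n)"
    using n by simp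
  also have "\<dots> \<le> (1 + 1 / real n) ^ (2 * n)"
    by (rule Bernoulli_inequality) (use n in \<open>simp add: field_simps\<close>)
  also have "1 + 1 / real n = real (Suc n) / real n"
    using n by (simp add: field_simps)
  finally have b: "3 * real n ^ (2 * n) \<le> real (Suc n) ^ (2 * n)"
    using n by (simp add: power_divide field_simps)
  have "real (2 * Suc n + 1) * (fact (Suc n))\<^sup>2 * 2 ^ Suc n
      = (2 * real (2 * n + 3)) * ((fact n)\<^sup>2 * 2 ^ n) * (real (Suc n))\<^sup>2"
    unfolding fact_Suc power_mult_distrib by (simp add: algebra_simps)
  \<comment> \<open>This amounts to \<open>4 * n + 6 \<le> 6 * n + 3\<close>.\<close>
  also have "\<dots> \<le> (3 * real (2 * n + 1)) * ((fact n)\<^sup>2 * 2 ^ n) * (real (Suc n))\<^sup>2"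
    using Suc by (intro mult_right_mono) auto
  also have "\<dots> = 3 * (real (2 * n + 1) * (fact n)\<^sup>2 * 2 ^ n) * (real (Suc n))\<^sup>2"
    by (simp only: mult.assoc)
  also have "\<dots> \<le> 3 * real n ^ (2 * n) * (real (Suc n))\<^sup>2"
    using Suc.IH by (intro mult_right_mono mult_left_mono) auto
  also have "\<dots> \<le> real (Suc n) ^ (2 * n) * (real (Suc n))\<^sup>2"
    using b by (intro mult_right_mono) auto
  also have "\<dots> = real (Suc n) ^ (2 * Suc n)"
    by (simp flip: power_add)
  finally show ?case .
qed

theorem proposition8p1:
  fixes n :: nat
  shows "real (IS n) \<ge> 2 ^ (n * (n - 1)) / (real (2 * n + 1) * (fact n)\<^sup>2) \<and>
    (n \<ge> 7 \<longrightarrow> ln (real (IS n)) \<ge> real n * (real n * ln 2 - 2 * ln (real n)))"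
proof -
  define d where "d = real (2 * n + 1) * (fact n)\<^sup>2"
  have d: "d > 0"
    unfolding d_def by simp
  have "real (2 ^ (n * (n - 1))) \<le> real (IS n * ((2 * n + 1) * (fact n)\<^sup>2))"
    using IS_mult_ge of_nat_le_iff by blast
  then have "2 ^ (n * (n - 1)) \<le> real (IS n) * d"
    unfolding d_def by (simp add: algebra_simps)
  then have main: "2 ^ (n * (n - 1)) / d \<le> real (IS n)"
    using d by (simp add: divide_le_eq)
  have "real n * (real n * ln 2 - 2 * ln (real n)) \<le> ln (real (IS n))" if n: "n \<ge> 7"
  proof -
    have pos: "real n ^ (2 * n) > 0"
      using n by simp
    have "n * n = n * (n - 1) + n"
      using n by (simp add: algebra_simps)
    then have e: "(2::real) ^ (n * n) = 2 ^ (n * (n - 1)) * 2 ^ n"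
      by (simp only: power_add)
    have "2 ^ (n * (n - 1)) * (d * 2 ^ n) \<le> 2 ^ (n * (n - 1)) * real n ^ (2 * n)"
      using fact_square_bound[OF n] unfolding d_def by (intro mult_left_mono) auto
    \<comment> \<open>Dividing by \<open>d\<close> and \<open>real n ^ (2 * n)\<close> trades the
      factorials for a power whose logarithm is explicit.\<close>
    then have "2 ^ (n * n) / real n ^ (2 * n) \<le> 2 ^ (n * (n - 1)) / d"
      unfolding e using d pos by (simp add: divide_le_eq le_divide_eq pos_divide_le_eq mult_ac)
    also note main
    finally have "ln (2 ^ (n * n) / real n ^ (2 * n)) \<le> ln (real (IS n))"
      using pos by (intro ln_mono) auto
    moreover have "ln (2 ^ (n * n) / real n ^ (2 * n)) = real n * (real n * ln 2 - 2 * ln (real n))"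
      using n by (simp add: ln_div ln_realpow algebra_simps)
    ultimately show ?thesis by simp
  qed
  with main show ?thesis
    unfolding d_def by blast
qed

end
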